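(* Let $d\ge2$ be a fixed integer and let $\mathcal I^c$ be an intricacy. (1) Exchangeable systems have small intricacies. More precisely, for every $\epsilon>0$, $$\sup_{X\in\mathrm{EX}(d,N)}\mathcal I^c(X)=o(N^{2/3+\epsilon}),\qquad N\to+\infty.$$ In particular $$\lim_{N\to\infty}\frac1N\max_{X\in\mathrm{EX}(d,N)}\mathcal I^c(X)=0.$$ (2) For $N$ large enough and fixed $d$, the maximizers of $\mathcal X(d,N)\ni X\mapsto\mathcal I^c(X)$ are neither unique nor exchangeable; that is, there is more than one law in $\mathcal M(d,N)$ attaining the maximum of $\mathcal I^c$ over $\mathcal X(d,N)$, and no maximizer belongs to $\mathrm{EX}(d,N)$.
   Context: Notation. $\mathbb N^*=\{1,2,\dots\}$. For a random variable $X$ with values in a finite set, the entropy is $\mathrm H(X)=-\sum_x \mathbb P(X=x)\log \mathbb P(X=x)$ (with $0\log 0=0$), and for two such variables on the same probability space $\mathrm{MI}(X,Y)=\mathrm H(X)+\mathrm H(Y)-\mathrm H(X,Y)$ is their mutual information. Systems. For a finite set $I\subset\mathbb N^*$, a system is a family $X=(X_i)_{i\in I}$ of random variables on a common probability space, each with values in $\{0,\dots,d-1\}$. $\mathcal X(d,I)$ is the set of such systems, $\mathcal M(d,I)$ the set of their laws (all probability measures on $\{0,\dots,d-1\}^I$); $\mathcal X(d,N):=\mathcal X(d,\{1,\dots,N\})$, $\mathcal M(d,N):=\mathcal M(d,\{1,\dots,N\})$. For $S\subset I$: $X_S:=(X_i)_{i\in S}$ and $S^c:=I\setminus S$. $\mathrm{EX}(d,N)$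 is the set of $X\in\mathcal X(d,N)$ that are exchangeable, i.e. for every permutation $\sigma$ of $\{1,\dots,N\}$ the vectors $(X_1,\dots,X_N)$ and $(X_{\sigma(1)},\dots,X_{\sigma(N)})$ have the same law. A system of coefficients is a family of real numbers $c=(c^I_S)$, indexed by all finite $I\subset\mathbb N^*$ and all $S\subset I$, with $c^I_S\ge0$, $\sum_{S\subset I}c^I_S=1$ and $c^I_{S^c}=c^I_S$. The associated mutual information functional is $\mathcal I^c(X):=\sum_{S\subset I}c^I_S\,\mathrm{MI}(X_S,X_{S^c})$ for $X\in\mathcal X(d,I)$, with the convention $\mathrm{MI}(X_\emptyset,X_I)=\mathrm{MI}(X_I,X_\emptyset)=0$; it depends only on the law of $X$. The functional $\mathcal I^c$ is exchangeable if for all finite $I,J\subset\mathbb N^*$ and every bijection $\phi:I\to J$, $\mathcal I^c(X)=\mathcal I^c(Y)$ whenever $X=(X_i)_{i\in I}$ and $Y=(X_{\phi^{-1}(j)})_{j\in J}$. It is weakly additive if $\mathcal I^c(X,Y)=\mathcal I^c(X)+\mathcal I^c(Y)$ for any two independent systems $X=(X_i)_{i\in I}$, $Y=(Y_j)_{j\in J}$, where $(X,Y)$ is the joint system indexed by the disjoint union $I\sqcup J$. An intricacy is a mutual information functional that is exchangeable and weakly additive.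
   Formalization: Part (2) is stated only for intricacies that are not identically zero: the coefficients 1/2 on S=∅ and S=I (and 1 when I=∅) give the zero intricacy, for which every system, exchangeable ones included, is a maximizer, so (2) fails. *)

theory Defs
  imports
    "HOL-Probability.Probability"
    "HOL-Combinatorics.Combinatorics"
    "HOL-Library.Infinite_Typeclass"
    "HOL-Library.Landau_Symbols"
begin

subsection \<open>Entropy and mutual information of random variables with finitely many values\<close>

text \<open>Logarithms are natural: base \<open>exp 1\<close> in the library's entropy.\<close>

definition ent :: "'w measure \<Rightarrow> ('w \<Rightarrow> 'b) \<Rightarrow> real" where
  "ent M X = prob_space.entropy M (exp 1) (count_space (X ` space M)) X"

definition MI :: "'w measure \<Rightarrow> ('w \<Rightarrow> 'b) \<Rightarrow> ('w \<Rightarrow> 'c) \<Rightarrow> real" where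
  "MI M X Y = ent M X + ent M Y - ent M (\<lambda>\<omega>. (X \<omega>, Y \<omega>))"

lemma ent_eq_sum:
  assumes "prob_space M" and "simple_function M X"
  shows "ent M X = - (\<Sum>x\<in>X ` space M.
    measure M (X -` {x} \<inter> space M) * ln (measure M (X -` {x} \<inter> space M)))"
proof -
  interpret prob_space M by fact
  interpret information_space M "exp 1"
    by unfold_locales simp
  show ?thesis
    unfolding ent_def
    by (subst entropy_simple_distributed[OF simple_distributedI[OF assms(2) measure_nonneg refl]])
       (simp add: log_def)
qed

subsection \<open>Systems and their laws\<close>

text \<open>
  Index sets are finite subsets of the positive integers. A system is a probability space together
  with a family of random variables; the family is a function on all of \<open>nat\<close>, of which only the
  values at indices in \<open>I\<close> matter.
\<close>

definition index_set :: "nat set \<Rightarrow> bool" where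
  "index_set I \<longleftrightarrow> finite I \<and> 0 \<notin> I"

type_synonym 'w system = "'w measure \<times> (nat \<Rightarrow> 'w \<Rightarrow> nat)"

abbreviation state_space :: "nat \<Rightarrow> nat set \<Rightarrow> (nat \<Rightarrow> nat) measure" where
  "state_space d I \<equiv> Pi\<^sub>M I (\<lambda>_. count_space {..<d})"

definition systems :: "nat \<Rightarrow> nat set \<Rightarrow> 'w system set" where
  "systems d I = {(M, X). prob_space M \<and> (\<forall>i\<in>I. X i \<in> M \<rightarrow>\<^sub>M count_space {..<d})}"

definition sub_vec :: "(nat \<Rightarrow> 'w \<Rightarrow> nat) \<Rightarrow> nat set \<Rightarrow> 'w \<Rightarrow> nat \<Rightarrow> nat" where
  "sub_vec X S = (\<lambda>\<omega>. \<lambda>i\<in>S. X i \<omega>)"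

definition law :: "nat \<Rightarrow> nat set \<Rightarrow> 'w system \<Rightarrow> (nat \<Rightarrow> nat) measure" where
  "law d I = (\<lambda>(M, X). distr M (state_space d I) (sub_vec X I))"

definition laws :: "nat \<Rightarrow> nat set \<Rightarrow> (nat \<Rightarrow> nat) measure set" where
  "laws d I = {\<mu>. prob_space \<mu> \<and> sets \<mu> = sets (state_space d I)}"

definition exch_systems :: "nat \<Rightarrow> nat \<Rightarrow> 'w system set" where
  "exch_systems d N = {(M, X) \<in> systems d {1..N}.
     \<forall>\<sigma>. \<sigma> permutes {1..N} \<longrightarrow> law d {1..N} (M, \<lambda>i. X (\<sigma> i)) = law d {1..N} (M, X)}"

lemma law_in_laws:
  assumes "(M, X) \<in> systems d I"
  shows "law d I (M, X) \<in> laws d I"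
proof -
  from assms have "prob_space M" and "sub_vec X I \<in> M \<rightarrow>\<^sub>M state_space d I"
    by (auto simp: systems_def sub_vec_def intro!: measurable_restrict)
  then show ?thesis
    by (auto simp: law_def laws_def intro: prob_space.prob_space_distr)
qed

text \<open>
  A variable ranging over systems has a fixed type of sample points. This loses nothing as soon as
  that type is infinite, because all laws on finite products of \<open>{..<d}\<close> are then realised.
\<close>

lemma laws_realised:
  assumes "index_set I" and "\<mu> \<in> laws d I"
  shows "\<exists>M X. (M, X :: nat \<Rightarrow> 'w::infinite \<Rightarrow> nat) \<in> systems d I \<and> law d I (M, X) = \<mu>"
proof -
  let ?E = "I \<rightarrow>\<^sub>E {..<d}"
  have fin: "finite I" using assms by (simp add: index_set_def)
  have st: "state_space d I = count_space ?E"
    using fin by (intro count_space_PiM_finite) auto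
  interpret \<mu>: prob_space \<mu> using assms by (simp add: laws_def)
  have sets_mu: "sets \<mu> = sets (count_space ?E)" using assms st by (simp add: laws_def)
  have finE: "finite ?E" using fin by (intro finite_PiE) auto
  obtain f :: "(nat \<Rightarrow> nat) \<Rightarrow> 'w" where inj: "inj_on f ?E"
    using arb_inj_on_finite_infinite[OF finE] by auto
  define M where "M = distr \<mu> (count_space (f ` ?E)) f"
  define X where "X = (\<lambda>i \<omega>. inv_into ?E f \<omega> i)"
  have f: "f \<in> \<mu> \<rightarrow>\<^sub>M count_space (f ` ?E)"
    by (subst measurable_cong_sets[OF sets_mu refl]) auto
  have X: "X i \<in> M \<rightarrow>\<^sub>M count_space {..<d}" if "i \<in> I" for i
    using that by (auto simp: M_def X_def inv_into_f_f[OF inj])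
  have sys: "(M, X) \<in> systems d I"
    using X \<mu>.prob_space_distr[OF f] by (auto simp: systems_def M_def)
  have sub: "sub_vec X I \<in> M \<rightarrow>\<^sub>M state_space d I"
    using X by (auto simp: sub_vec_def intro!: measurable_restrict)
  have "law d I (M, X) = distr \<mu> (state_space d I) (sub_vec X I \<circ> f)"
    using sub by (simp add: law_def M_def distr_distr[OF _ f])
  also have "\<dots> = distr \<mu> \<mu> (\<lambda>x. x)"
  proof (rule distr_cong)
    show "sets (state_space d I) = sets \<mu>" using st sets_mu by simp
    fix x assume "x \<in> space \<mu>"
    then have x: "x \<in> ?E" using sets_eq_imp_space_eq[OF sets_mu] by simp
    show "(sub_vec X I \<circ> f) x = x"
      using x by (simp add: sub_vec_def X_def inv_into_f_f[OF inj x] PiE_restrict)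
  qed simp
  also have "\<dots> = \<mu>" by simp
  finally show ?thesis using sys by blast
qed

subsection \<open>Mutual information functionals and intricacies\<close>

text \<open>\<open>c I S\<close> is the coefficient written \<open>c\<close> with upper index \<open>I\<close> and lower index \<open>S\<close>.\<close>

definition coefficient_system :: "(nat set \<Rightarrow> nat set \<Rightarrow> real) \<Rightarrow> bool" where
  "coefficient_system c \<longleftrightarrow> (\<forall>I. index_set I \<longrightarrow>
     (\<forall>S\<subseteq>I. c I S \<ge> 0 \<and> c I (I - S) = c I S) \<and> (\<Sum>S\<in>Pow I. c I S) = 1)"

text \<open>
  For \<open>S = {}\<close> and \<open>S = I\<close> no convention is needed: the empty vector is constant, so the mutual
  information is \<open>0\<close> (lemma \<open>MI_trivial\<close>).
\<close>

definition mi_functional ::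
  "(nat set \<Rightarrow> nat set \<Rightarrow> real) \<Rightarrow> nat set \<Rightarrow> 'w system \<Rightarrow> real" where
  "mi_functional c I =
     (\<lambda>(M, X). \<Sum>S\<in>Pow I. c I S * MI M (sub_vec X S) (sub_vec X (I - S)))"

definition exchangeable_functional ::
  "'w itself \<Rightarrow> nat \<Rightarrow> (nat set \<Rightarrow> nat set \<Rightarrow> real) \<Rightarrow> bool" where
  "exchangeable_functional _ d c \<longleftrightarrow>
     (\<forall>I J \<phi> M (X :: nat \<Rightarrow> 'w \<Rightarrow> nat).
        index_set I \<longrightarrow> index_set J \<longrightarrow> bij_betw \<phi> I J \<longrightarrow> (M, X) \<in> systems d I \<longrightarrow>
        mi_functional c I (M, X) = mi_functional c J (M, \<lambda>j. X (inv_into I \<phi> j)))"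

definition weakly_additive ::
  "'w itself \<Rightarrow> nat \<Rightarrow> (nat set \<Rightarrow> nat set \<Rightarrow> real) \<Rightarrow> bool" where
  "weakly_additive _ d c \<longleftrightarrow>
     (\<forall>I J M (X :: nat \<Rightarrow> 'w \<Rightarrow> nat) Y.
        index_set I \<longrightarrow> index_set J \<longrightarrow> I \<inter> J = {} \<longrightarrow>
        (M, X) \<in> systems d I \<longrightarrow> (M, Y) \<in> systems d J \<longrightarrow>
        prob_space.indep_var M (state_space d I) (sub_vec X I) (state_space d J) (sub_vec Y J) \<longrightarrow>
        mi_functional c (I \<union> J) (M, \<lambda>k. if k \<in> I then X k else Y k) =
          mi_functional c I (M, X) + mi_functional c J (M, Y))"

definition intricacy ::
  "'w itself \<Rightarrow> nat \<Rightarrow> (nat set \<Rightarrow> nat set \<Rightarrow> real) \<Rightarrow> bool" where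
  "intricacy T d c \<longleftrightarrow>
     coefficient_system c \<and> exchangeable_functional T d c \<and> weakly_additive T d c"

text \<open>
  The coefficients that put all their mass on the trivial splittings \<open>S = {}\<close> and \<open>S = I\<close> define
  the zero functional, which is an intricacy (lemma \<open>intricacy_null\<close>). Every system maximizes it,
  so statements about the shape of maximizers have to exclude it.
\<close>

definition nonnull_functional ::
  "'w itself \<Rightarrow> nat \<Rightarrow> (nat set \<Rightarrow> nat set \<Rightarrow> real) \<Rightarrow> bool" where
  "nonnull_functional _ d c \<longleftrightarrow>
     (\<exists>I (X :: 'w system). index_set I \<and> X \<in> systems d I \<and> mi_functional c I X \<noteq> 0)"

definition maximizers ::
  "nat \<Rightarrow> (nat set \<Rightarrow> nat set \<Rightarrow> real) \<Rightarrow> nat \<Rightarrow> 'w system set" where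
  "maximizers d c N =
     {X. is_arg_max (mi_functional c {1..N}) (\<lambda>X. X \<in> systems d {1..N}) X}"

lemma simple_function_sub_vec:
  assumes "(M, X) \<in> systems d I" "finite S" "S \<subseteq> I"
  shows "simple_function M (sub_vec X S)"
proof -
  have st: "state_space d S = count_space (S \<rightarrow>\<^sub>E {..<d})"
    using assms by (intro count_space_PiM_finite) auto
  have "sub_vec X S \<in> M \<rightarrow>\<^sub>M state_space d S"
    using assms by (auto simp: systems_def sub_vec_def intro!: measurable_restrict)
  then have m: "sub_vec X S \<in> M \<rightarrow>\<^sub>M count_space (S \<rightarrow>\<^sub>E {..<d})" by (simp add: st)
  have "finite (S \<rightarrow>\<^sub>E {..<d})" using assms by (intro finite_PiE) auto
  moreover have "sub_vec X S ` space M \<subseteq> S \<rightarrow>\<^sub>E {..<d}"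
    using measurable_space[OF m] by auto
  ultimately have fin: "finite (sub_vec X S ` space M)" by (rule rev_finite_subset)
  show ?thesis
    unfolding simple_function_def
  proof (intro conjI fin ballI)
    fix x assume "x \<in> sub_vec X S ` space M"
    then have "{x} \<in> sets (count_space (S \<rightarrow>\<^sub>E {..<d}))" using measurable_space[OF m] by auto
    then show "sub_vec X S -` {x} \<inter> space M \<in> sets M" by (rule measurable_sets[OF m])
  qed
qed

lemma ent_inj_comp:
  assumes "prob_space M" "simple_function M X" "inj_on g (X ` space M)"
  shows "ent M (\<lambda>\<omega>. g (X \<omega>)) = ent M X"
proof -
  have "ent M (\<lambda>\<omega>. g (X \<omega>)) = - (\<Sum>y\<in>g ` X ` space M.
      measure M ((\<lambda>\<omega>. g (X \<omega>)) -` {y} \<inter> space M) *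
      ln (measure M ((\<lambda>\<omega>. g (X \<omega>)) -` {y} \<inter> space M)))"
    using assms by (subst ent_eq_sum) (auto simp: image_image intro: simple_function_compose1)
  also have "\<dots> = - (\<Sum>x\<in>X ` space M.
      measure M (X -` {x} \<inter> space M) * ln (measure M (X -` {x} \<inter> space M)))"
  proof -
    have "(\<lambda>\<omega>. g (X \<omega>)) -` {g x} \<inter> space M = X -` {x} \<inter> space M" if "x \<in> X ` space M" for x
      using that assms(3) by (auto dest: inj_onD)
    then show ?thesis using assms(3) by (simp add: sum.reindex)
  qed
  finally show ?thesis using ent_eq_sum[OF assms(1,2)] by simp
qed

lemma MI_trivial:
  assumes "index_set I" "(M, X) \<in> systems d I"
  shows "MI M (sub_vec X {}) (sub_vec X I) = 0" "MI M (sub_vec X I) (sub_vec X {}) = 0"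
proof -
  interpret prob_space M using assms by (simp add: systems_def)
  have e: "sub_vec X {} = (\<lambda>_. \<lambda>_. undefined)" by (simp add: sub_vec_def restrict_def)
  have sf: "simple_function M (sub_vec X I)"
    using assms by (intro simple_function_sub_vec) (auto simp: index_set_def)
  have z: "ent M (\<lambda>_. (\<lambda>_. undefined) :: nat \<Rightarrow> nat) = 0"
    by (subst ent_eq_sum) (auto simp: prob_space_axioms image_constant_conv not_empty prob_space)
  have "ent M (\<lambda>\<omega>. ((\<lambda>_. undefined) :: nat \<Rightarrow> nat, sub_vec X I \<omega>)) = ent M (sub_vec X I)"
    by (rule ent_inj_comp[where g="Pair _"]) (auto simp: prob_space_axioms sf inj_on_def)
  moreover have "ent M (\<lambda>\<omega>. (sub_vec X I \<omega>, (\<lambda>_. undefined) :: nat \<Rightarrow> nat)) = ent M (sub_vec X I)"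
    by (rule ent_inj_comp[where g="\<lambda>x. (x, _)"]) (auto simp: prob_space_axioms sf inj_on_def)
  ultimately show "MI M (sub_vec X {}) (sub_vec X I) = 0" "MI M (sub_vec X I) (sub_vec X {}) = 0"
    by (simp_all add: MI_def e z)
qed

definition null_coefficients :: "nat set \<Rightarrow> nat set \<Rightarrow> real" where
  "null_coefficients I S =
     (if I = {} then 1 else if S = {} \<or> S = I then 1 / 2 else 0)"

lemma mi_functional_null:
  assumes "index_set I" "(M, X) \<in> systems d I"
  shows "mi_functional null_coefficients I (M, X) = 0"
proof -
  have "null_coefficients I S * MI M (sub_vec X S) (sub_vec X (I - S)) = 0" if "S \<subseteq> I" for S
    using that MI_trivial[OF assms]
    by (cases "S = {} \<or> S = I") (auto simp: null_coefficients_def)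
  then show ?thesis unfolding mi_functional_def by (auto intro: sum.neutral)
qed

lemma intricacy_null: "intricacy TYPE('w) d null_coefficients"
  unfolding intricacy_def
proof (intro conjI)
  have "(\<Sum>S\<in>Pow I. null_coefficients I S) = 1" if I: "index_set I" for I
  proof (cases "I = {}")
    case False
    have "(\<Sum>S\<in>Pow I. null_coefficients I S) = (\<Sum>S\<in>{{}, I}. null_coefficients I S)"
      using I False
      by (intro sum.mono_neutral_right) (auto simp: null_coefficients_def index_set_def)
    with False show ?thesis by (simp add: null_coefficients_def)
  qed (simp add: null_coefficients_def)
  then show "coefficient_system null_coefficients"
    by (auto simp: coefficient_system_def null_coefficients_def)
  show "exchangeable_functional TYPE('w) d null_coefficients"
    unfolding exchangeable_functional_def
  proof (intro allI impI)
    fix I J \<phi> M and X :: "nat \<Rightarrow> 'w \<Rightarrow> nat"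
    assume *: "index_set I" "index_set J" "bij_betw \<phi> I J" "(M, X) \<in> systems d I"
    then have "(M, \<lambda>j. X (inv_into I \<phi> j)) \<in> systems d J"
      by (auto simp: systems_def bij_betw_def inv_into_into)
    with * show "mi_functional null_coefficients I (M, X) =
        mi_functional null_coefficients J (M, \<lambda>j. X (inv_into I \<phi> j))"
      by (simp add: mi_functional_null)
  qed
  show "weakly_additive TYPE('w) d null_coefficients"
    unfolding weakly_additive_def
  proof (intro allI impI)
    fix I J M and X Y :: "nat \<Rightarrow> 'w \<Rightarrow> nat"
    assume *: "index_set I" "index_set J" "(M, X) \<in> systems d I" "(M, Y) \<in> systems d J"
    then have "(M, \<lambda>k. if k \<in> I then X k else Y k) \<in> systems d (I \<union> J)" "index_set (I \<union> J)"
      by (auto simp: systems_def index_set_def)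
    with * show "mi_functional null_coefficients (I \<union> J) (M, \<lambda>k. if k \<in> I then X k else Y k) =
        mi_functional null_coefficients I (M, X) + mi_functional null_coefficients J (M, Y)"
      by (simp add: mi_functional_null)
  qed
qed

end

theory Submission
  imports Defs "HOL-Real_Asymp.Real_Asymp"
begin

text \<open>
  Two growth rates collide. For an exchangeable system the mutual information between the
  coordinates in \<open>S\<close> and the remaining ones is at most \<open>d * ln (N + 1)\<close>: once the number of
  occurrences of each value in \<open>S\<close> is known, the configuration on \<open>S\<close> is uniform among those
  with these counts and independent of the rest, so only these counts can carry information, and
  they take at most \<open>(N + 1) ^ d\<close> values (\<open>exchangeable_MI_le\<close>). The coefficients are a probability on the subsets
  \<open>S\<close>, so the functional inherits the bound. This logarithmic bound is far below the power of \<open>N\<close> in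
  the first assertion.

  Over all systems the maximum grows linearly, unless the functional is zero. Mutual information is
  nonnegative, so a nonzero value of the functional is some \<open>\<delta> > 0\<close>, attained on some index set of
  size \<open>m\<close>. By exchangeability and weak additivity, independent copies of this system on disjoint
  blocks of \<open>{1..N}\<close> have total value at least \<open>(N div m) * \<delta>\<close> (\<open>maximum_grows_linearly\<close>).

  Hence for large \<open>N\<close> no exchangeable system is a maximizer. Maximizers exist, because the functional
  is a continuous function of the law and the laws form a compact set
  (\<open>ex_arg_max_mi_functional\<close>). A maximizer is not exchangeable, so some permutation of its
  indices gives it a different law, and the permuted system is again a maximizer
  (\<open>maximizer_with_other_law\<close>).
\<close>

section \<open>Entropy and mutual information as finite sums\<close>

definition shannon :: "'a set \<Rightarrow> ('a \<Rightarrow> real) \<Rightarrow> real" where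
  "shannon A p = - (\<Sum>x\<in>A. p x * ln (p x))"

definition marginal :: "'a set \<Rightarrow> ('a \<Rightarrow> real) \<Rightarrow> ('a \<Rightarrow> 'b) \<Rightarrow> 'b \<Rightarrow> real" where
  "marginal E p f a = (\<Sum>x | x \<in> E \<and> f x = a. p x)"

lemma shannon_cong: "(\<And>x. x \<in> A \<Longrightarrow> p x = q x) \<Longrightarrow> shannon A p = shannon A q"
  unfolding shannon_def by simp

lemma ent_eq_shannon:
  assumes "prob_space M" "simple_function M X" "finite A" "X ` space M \<subseteq> A"
  shows "ent M X = shannon A (\<lambda>x. measure M (X -` {x} \<inter> space M))"
proof -
  have "X -` {x} \<inter> space M = {}" if "x \<notin> X ` space M" for x
    using that by auto
  then have "(\<Sum>x\<in>A. measure M (X -` {x} \<inter> space M) * ln (measure M (X -` {x} \<inter> space M))) =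
      (\<Sum>x\<in>X ` space M. measure M (X -` {x} \<inter> space M) * ln (measure M (X -` {x} \<inter> space M)))"
    using assms(3,4) by (intro sum.mono_neutral_right) auto
  then show ?thesis
    using ent_eq_sum[OF assms(1,2)] by (simp add: shannon_def)
qed

lemma MI_nonneg:
  assumes "prob_space M" and X: "simple_function M X" and Y: "simple_function M Y"
  shows "0 \<le> MI M X Y"
proof -
  interpret prob_space M by fact
  interpret information_space M "exp 1" by unfold_locales simp
  have "ent M (\<lambda>\<omega>. prod.swap (Y \<omega>, X \<omega>)) = ent M (\<lambda>\<omega>. (Y \<omega>, X \<omega>))"
    by (rule ent_inj_comp[OF prob_space_axioms simple_function_Pair[OF Y X]]) (auto simp: inj_on_def)
  then have "MI M X Y = mutual_information (exp 1) (count_space (X ` space M)) (count_space (Y ` space M)) X Y"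
    using entropy_chain_rule[OF Y X]
      mutual_information_eq_entropy_conditional_entropy[OF X Y]
    by (simp add: MI_def ent_def)
  then show ?thesis using mutual_information_nonneg_simple[OF X Y] by simp
qed

text \<open>
  The mutual information of \<open>f\<close> and \<open>g\<close> is \<open>H(f) - H(f | g)\<close>. If, given \<open>g\<close>, every value \<open>a\<close> of
  \<open>f\<close> has conditional probability at most \<open>1 / n a\<close>, then \<open>H(f | g) \<ge> E[ln (n f)]\<close>. On the other
  hand \<open>1 / (n a * K)\<close> is a sub-probability on the values of \<open>f\<close>, so Gibbs' inequality gives
  \<open>H(f) \<le> ln K + E[ln (n f)]\<close>. In the difference the two expectations cancel. The point
  of \<open>E\<close> is meant to be determined by the pair of values of \<open>f\<close> and \<open>g\<close>, so that \<open>shannon E p\<close> is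
  their joint entropy.
\<close>

lemma mutual_information_le_ln:
  fixes p :: "'a \<Rightarrow> real" and f :: "'a \<Rightarrow> 'b" and g :: "'a \<Rightarrow> 'c"
  assumes fin: "finite E" "finite A" "finite B" and f: "f ` E \<subseteq> A" and g: "g ` E \<subseteq> B"
    and p: "\<And>x. x \<in> E \<Longrightarrow> 0 \<le> p x" "sum p E = 1"
    and n: "\<And>a. a \<in> A \<Longrightarrow> 0 < n a"
    and spread: "\<And>x. x \<in> E \<Longrightarrow> n (f x) * p x \<le> marginal E p g (g x)"
    and K: "(\<Sum>a\<in>A. 1 / n a) \<le> K"
  shows "shannon A (marginal E p f) + shannon B (marginal E p g) - shannon E p \<le> ln K"
proof -
  let ?pf = "marginal E p f" and ?pg = "marginal E p g"
  have pf: "0 \<le> ?pf a" for a unfolding marginal_def using p by (auto intro: sum_nonneg)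
  \<comment> \<open>Sums over the values of \<open>f\<close>, weighted by its law, are sums over the sample space.\<close>
  have group: "(\<Sum>a\<in>A. ?pf a * h a) = (\<Sum>x\<in>E. p x * h (f x))" for h :: "'b \<Rightarrow> real"
    using sum.group[OF fin(1,2) f, of "\<lambda>x. p x * h (f x)"]
    by (simp add: marginal_def sum_distrib_right)
  have "shannon B ?pg = - (\<Sum>x\<in>E. p x * ln (?pg (g x)))"
    using sum.group[OF fin(1,3) g, of "\<lambda>x. p x * ln (?pg (g x))"]
    by (simp add: shannon_def marginal_def sum_distrib_right)
  then have "shannon B ?pg - shannon E p = (\<Sum>x\<in>E. p x * (ln (p x) - ln (?pg (g x))))"
    by (simp add: shannon_def right_diff_distrib sum_subtractf)
  also have "\<dots> \<le> (\<Sum>x\<in>E. p x * (- ln (n (f x))))"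
  proof (intro sum_mono)
    fix x assume x: "x \<in> E"
    show "p x * (ln (p x) - ln (?pg (g x))) \<le> p x * (- ln (n (f x)))"
    proof (cases "p x = 0")
      case False
      have "0 < n (f x)" using x f n by auto
      moreover have px: "0 < p x" using False p(1)[OF x] by simp
      ultimately have "ln (n (f x)) + ln (p x) = ln (n (f x) * p x)" by (simp add: ln_mult)
      also have "\<dots> \<le> ln (?pg (g x))"
        using spread[OF x] \<open>0 < n (f x)\<close> px by (intro ln_mono) auto
      finally show ?thesis using px by (intro mult_left_mono) auto
    qed simp
  qed
  also have "\<dots> = (\<Sum>a\<in>A. ?pf a * (- ln (n a)))"
    by (rule group[symmetric])
  finally have "shannon A ?pf + shannon B ?pg - shannon E p \<le>
      (\<Sum>a\<in>A. ?pf a * (- ln (n a))) - (\<Sum>a\<in>A. ?pf a * ln (?pf a))"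
    by (simp add: shannon_def)
  also have "\<dots> = (\<Sum>a\<in>A. ?pf a * (- ln (n a) - ln (?pf a)))"
    by (simp add: right_diff_distrib sum_subtractf)
  also have "\<dots> \<le> (\<Sum>a\<in>A. ?pf a * ln K + (1 / n a / K - ?pf a))"
  proof (intro sum_mono)
    fix a assume a: "a \<in> A"
    have "0 < (\<Sum>a\<in>A. 1 / n a)" using a n fin by (intro sum_pos) auto
    then have K0: "0 < K" using K by simp
    have na: "0 < n a" using n a by auto
    show "?pf a * (- ln (n a) - ln (?pf a)) \<le> ?pf a * ln K + (1 / n a / K - ?pf a)"
    proof (cases "?pf a = 0")
      case False
      then have pa: "0 < ?pf a" using pf[of a] by simp
      have "- ln (n a) - ln (?pf a) - ln K = ln (1 / (n a * ?pf a * K))"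
        using na pa K0 by (simp add: ln_mult ln_div)
      \<comment> \<open>Gibbs' inequality, term by term.\<close>
      also have "\<dots> \<le> 1 / (n a * ?pf a * K) - 1"
        using na pa K0 by (intro ln_le_minus_one) simp
      finally have "?pf a * (- ln (n a) - ln (?pf a) - ln K) \<le> ?pf a * (1 / (n a * ?pf a * K) - 1)"
        using pa by (intro mult_left_mono) auto
      also have "\<dots> = 1 / n a / K - ?pf a" using pa na K0 by (simp add: field_simps)
      finally show ?thesis by (simp add: algebra_simps)
    qed (use na K0 in simp)
  qed
  also have "\<dots> = ln K * sum ?pf A + ((\<Sum>a\<in>A. 1 / n a) / K - sum ?pf A)"
    by (simp add: sum.distrib sum_subtractf sum_distrib_left sum_divide_distrib mult.commute)
  also have "sum ?pf A = 1" using group[of "\<lambda>_. 1"] p by simp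
  also have "ln K * 1 + ((\<Sum>a\<in>A. 1 / n a) / K - 1) \<le> ln K"
  proof -
    have "A \<noteq> {}" using \<open>sum ?pf A = 1\<close> by auto
    then have "0 < (\<Sum>a\<in>A. 1 / n a)" using n fin by (intro sum_pos) auto
    then show ?thesis using K by simp
  qed
  finally show ?thesis .
qed

section \<open>The functional as a function of the law\<close>

abbreviation configs :: "nat \<Rightarrow> nat set \<Rightarrow> (nat \<Rightarrow> nat) set" where
  "configs d I \<equiv> I \<rightarrow>\<^sub>E {..<d}"

text \<open>
  A law on a finite product is identified with its point masses, an element of the function space
  \<open>(nat \<Rightarrow> nat) \<Rightarrow> real\<close>. Compactness and continuity are available there, and systems on different
  probability spaces become comparable.
\<close>

definition law_weights :: "nat \<Rightarrow> nat set \<Rightarrow> 'w system \<Rightarrow> (nat \<Rightarrow> nat) \<Rightarrow> real" where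
  "law_weights d I X x = measure (law d I X) {x}"

definition weights_functional ::
  "(nat set \<Rightarrow> nat set \<Rightarrow> real) \<Rightarrow> nat \<Rightarrow> nat set \<Rightarrow> ((nat \<Rightarrow> nat) \<Rightarrow> real) \<Rightarrow> real" where
  "weights_functional c d I p = (\<Sum>S\<in>Pow I. c I S *
     (shannon (configs d S) (marginal (configs d I) p (\<lambda>x. restrict x S)) +
      shannon (configs d (I - S)) (marginal (configs d I) p (\<lambda>x. restrict x (I - S))) -
      shannon (configs d I) p))"

lemma sets_state_space: "finite I \<Longrightarrow> sets (state_space d I) = Pow (configs d I)"
  by (subst count_space_PiM_finite) auto

lemma finite_configs: "finite I \<Longrightarrow> finite (configs d I)"
  by (intro finite_PiE) auto

lemma sets_laws: "finite I \<Longrightarrow> \<mu> \<in> laws d I \<Longrightarrow> sets \<mu> = Pow (configs d I)"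
  by (simp add: laws_def sets_state_space)

lemma measurable_sub_vec:
  "(M, X) \<in> systems d I \<Longrightarrow> S \<subseteq> I \<Longrightarrow> sub_vec X S \<in> M \<rightarrow>\<^sub>M state_space d S"
  by (auto simp: systems_def sub_vec_def intro!: measurable_restrict)

lemma sub_vec_in_configs:
  assumes "(M, X) \<in> systems d I" "S \<subseteq> I"
  shows "sub_vec X S ` space M \<subseteq> configs d S"
  using assms measurable_space[of "X _" M] by (fastforce simp: systems_def sub_vec_def)

lemma law_weights_eq:
  assumes "(M, X) \<in> systems d I" "finite I" "x \<in> configs d I"
  shows "law_weights d I (M, X) x = measure M (sub_vec X I -` {x} \<inter> space M)"
  using assms measurable_sub_vec[OF assms(1) order_refl]
  by (simp add: law_weights_def law_def measure_distr sets_state_space)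

lemma ent_sub_vec:
  assumes sys: "(M, X) \<in> systems d I" and I: "finite I" and S: "S \<subseteq> I"
  shows "ent M (sub_vec X S) =
    shannon (configs d S) (marginal (configs d I) (law_weights d I (M, X)) (\<lambda>x. restrict x S))"
proof -
  interpret prob_space M using sys by (simp add: systems_def)
  have \<mu>: "law d I (M, X) \<in> laws d I" using law_in_laws[OF sys] .
  interpret \<mu>: prob_space "law d I (M, X)" using \<mu> by (simp add: laws_def)
  have "measure M (sub_vec X S -` {y} \<inter> space M) =
      marginal (configs d I) (law_weights d I (M, X)) (\<lambda>x. restrict x S) y" for y
  proof -
    let ?F = "{x \<in> configs d I. restrict x S = y}"
    have "restrict (sub_vec X I \<omega>) S = sub_vec X S \<omega>" for \<omega>
      using S by (auto simp: sub_vec_def fun_eq_iff)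
    moreover have "sub_vec X I \<omega> \<in> configs d I" if "\<omega> \<in> space M" for \<omega>
      using that sub_vec_in_configs[OF sys order_refl] by (rule_tac subsetD) auto
    ultimately have "sub_vec X S -` {y} \<inter> space M = sub_vec X I -` ?F \<inter> space M"
      by (simp add: set_eq_iff) metis
    also have "measure M \<dots> = measure (law d I (M, X)) ?F"
      using measurable_sub_vec[OF sys order_refl] I
      by (simp add: law_def measure_distr sets_state_space)
    also have "\<dots> = (\<Sum>x\<in>?F. measure (law d I (M, X)) {x})"
      using I sets_laws[OF I \<mu>]
      by (intro \<mu>.finite_measure_eq_sum_singleton) (auto intro: finite_subset[OF _ finite_configs])
    finally show ?thesis by (simp add: marginal_def law_weights_def)
  qed
  moreover have "simple_function M (sub_vec X S)"
    using simple_function_sub_vec[OF sys] I S by (auto intro: finite_subset)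
  ultimately show ?thesis
    using sub_vec_in_configs[OF sys S] I S
    by (subst ent_eq_shannon[OF prob_space_axioms _ finite_configs])
       (auto intro: finite_subset)
qed

lemma ent_sub_vec_pair:
  assumes sys: "(M, X) \<in> systems d I" and I: "finite I" and S: "S \<subseteq> I"
  shows "ent M (\<lambda>\<omega>. (sub_vec X S \<omega>, sub_vec X (I - S) \<omega>)) =
    shannon (configs d I) (law_weights d I (M, X))"
proof -
  interpret prob_space M using sys by (simp add: systems_def)
  have "(\<lambda>\<omega>. (sub_vec X S \<omega>, sub_vec X (I - S) \<omega>)) =
      (\<lambda>\<omega>. (\<lambda>x. (restrict x S, restrict x (I - S))) (sub_vec X I \<omega>))"
    using S by (auto simp: sub_vec_def fun_eq_iff)
  then have "ent M (\<lambda>\<omega>. (sub_vec X S \<omega>, sub_vec X (I - S) \<omega>)) =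
      ent M (\<lambda>\<omega>. (\<lambda>x. (restrict x S, restrict x (I - S))) (sub_vec X I \<omega>))"
    by (rule arg_cong)
  also have "\<dots> = ent M (sub_vec X I)"
  proof (rule ent_inj_comp[OF prob_space_axioms simple_function_sub_vec[OF sys I order_refl]])
    have "x = x'" if "x \<in> configs d I" "x' \<in> configs d I"
      "restrict x S = restrict x' S" "restrict x (I - S) = restrict x' (I - S)" for x x'
      using that(1,2)
    proof (rule PiE_ext)
      fix i assume "i \<in> I"
      then show "x i = x' i"
        using that(3,4)[THEN fun_cong, of i] by (cases "i \<in> S") auto
    qed
    then have "inj_on (\<lambda>x. (restrict x S, restrict x (I - S))) (configs d I)"
      by (auto intro!: inj_onI)
    then show "inj_on (\<lambda>x. (restrict x S, restrict x (I - S))) (sub_vec X I ` space M)"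
      by (rule inj_on_subset) (rule sub_vec_in_configs[OF sys order_refl])
  qed
  also have "\<dots> = shannon (configs d I) (marginal (configs d I) (law_weights d I (M, X)) (\<lambda>x. restrict x I))"
    by (rule ent_sub_vec[OF sys I order_refl])
  also have "shannon (configs d I) (marginal (configs d I) (law_weights d I (M, X)) (\<lambda>x. restrict x I)) =
      shannon (configs d I) (law_weights d I (M, X))"
  proof (rule shannon_cong)
    fix y assume "y \<in> configs d I"
    then have "{x. x \<in> configs d I \<and> restrict x I = y} = {y}"
      by (auto simp: PiE_restrict)
    then show "marginal (configs d I) (law_weights d I (M, X)) (\<lambda>x. restrict x I) y =
        law_weights d I (M, X) y"
      by (simp add: marginal_def)
  qed
  finally show ?thesis .
qed

lemma mi_functional_eq_weights:
  assumes "(M, X) \<in> systems d I" "finite I"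
  shows "mi_functional c I (M, X) = weights_functional c d I (law_weights d I (M, X))"
proof -
  have "c I S * MI M (sub_vec X S) (sub_vec X (I - S)) = c I S *
     (shannon (configs d S) (marginal (configs d I) (law_weights d I (M, X)) (\<lambda>x. restrict x S)) +
      shannon (configs d (I - S)) (marginal (configs d I) (law_weights d I (M, X)) (\<lambda>x. restrict x (I - S))) -
      shannon (configs d I) (law_weights d I (M, X)))" if "S \<subseteq> I" for S
    unfolding MI_def ent_sub_vec[OF assms that] ent_sub_vec[OF assms Diff_subset]
      ent_sub_vec_pair[OF assms that] ..
  then show ?thesis
    unfolding mi_functional_def weights_functional_def prod.case by (intro sum.cong) auto
qed

lemma mi_functional_nonneg:
  assumes "coefficient_system c" "index_set I" "(M, X) \<in> systems d I"
  shows "0 \<le> mi_functional c I (M, X)"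
proof -
  have "0 \<le> MI M (sub_vec X S) (sub_vec X (I - S))" if "S \<subseteq> I" for S
    using assms that
    by (intro MI_nonneg simple_function_sub_vec[OF assms(3)])
       (auto simp: systems_def index_set_def intro: finite_subset)
  with assms(1,2) show ?thesis
    unfolding mi_functional_def coefficient_system_def by (auto intro!: sum_nonneg)
qed

definition prob_weights :: "'a set \<Rightarrow> ('a \<Rightarrow> real) set" where
  "prob_weights E = {p. (\<forall>x\<in>E. 0 \<le> p x) \<and> (\<forall>x. x \<notin> E \<longrightarrow> p x = 0) \<and> sum p E = 1}"

lemma law_weights_in_prob_weights:
  assumes "(M, X) \<in> systems d I" "finite I"
  shows "law_weights d I (M, X) \<in> prob_weights (configs d I)"
proof -
  have \<mu>: "law d I (M, X) \<in> laws d I" using law_in_laws[OF assms(1)] .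
  interpret \<mu>: prob_space "law d I (M, X)" using \<mu> by (simp add: laws_def)
  have "space (law d I (M, X)) = configs d I"
    using sets_laws[OF assms(2) \<mu>] sets_eq_imp_space_eq[of _ "count_space (configs d I)"] by simp
  then have "sum (\<lambda>x. measure (law d I (M, X)) {x}) (configs d I) = 1"
    using \<mu>.finite_measure_eq_sum_singleton[OF finite_configs[OF assms(2)], of d]
      sets_laws[OF assms(2) \<mu>] \<mu>.prob_space by auto
  then show ?thesis
    using sets_laws[OF assms(2) \<mu>]
    by (auto simp: prob_weights_def law_weights_def measure_notin_sets)
qed

text \<open>
  Every point of the simplex comes from a system on the given infinite sample type, so maximizing
  over systems is the same as maximizing over a compact set of weights.
\<close>

lemma prob_weights_realised:
  assumes I: "index_set I" and p: "p \<in> prob_weights (configs d I)"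
  shows "\<exists>X :: 'w::infinite system. X \<in> systems d I \<and> law_weights d I X = p"
proof -
  let ?E = "configs d I"
  have fin: "finite I" "finite ?E" using I finite_configs by (auto simp: index_set_def)
  define \<mu> where "\<mu> = point_measure ?E (\<lambda>x. ennreal (p x))"
  have em: "emeasure \<mu> A = (\<Sum>x\<in>A. p x)" if "A \<subseteq> ?E" for A
    using that p fin(2) unfolding \<mu>_def
    by (subst emeasure_point_measure_finite) (auto simp: prob_weights_def subset_eq intro!: sum_ennreal)
  have "prob_space \<mu>"
    using em[OF order_refl] p by (intro prob_spaceI) (simp add: \<mu>_def space_point_measure prob_weights_def)
  then have \<mu>: "\<mu> \<in> laws d I"
    using fin by (simp add: laws_def \<mu>_def sets_point_measure sets_state_space)
  then obtain M and X :: "nat \<Rightarrow> 'w \<Rightarrow> nat" where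
    X: "(M, X) \<in> systems d I" "law d I (M, X) = \<mu>"
    using laws_realised[OF I] by blast
  have w: "measure \<mu> {x} = p x" for x
  proof (cases "x \<in> ?E")
    case True
    then show ?thesis using em[of "{x}"] p by (simp add: measure_def prob_weights_def)
  next
    case False
    then show ?thesis using p sets_laws[OF fin(1) \<mu>] by (simp add: measure_notin_sets prob_weights_def)
  qed
  have "law_weights d I (M, X) = p"
    unfolding law_weights_def X(2) by (rule ext) (rule w)
  then show ?thesis using X(1) by blast
qed

lemma law_eqI:
  assumes I: "finite I" and X: "(M, X) \<in> systems d I" and Y: "(M', Y) \<in> systems d I"
    and eq: "\<And>x. x \<in> configs d I \<Longrightarrow> law_weights d I (M, X) x = law_weights d I (M', Y) x"
  shows "law d I (M, X) = law d I (M', Y)"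
proof (rule measure_eqI_finite[OF sets_laws[OF I law_in_laws[OF X]] sets_laws[OF I law_in_laws[OF Y]]
    finite_configs[OF I]])
  interpret X: prob_space "law d I (M, X)" using law_in_laws[OF X] by (simp add: laws_def)
  interpret Y: prob_space "law d I (M', Y)" using law_in_laws[OF Y] by (simp add: laws_def)
  fix x assume "x \<in> configs d I"
  then show "emeasure (law d I (M, X)) {x} = emeasure (law d I (M', Y)) {x}"
    using eq by (simp add: X.emeasure_eq_measure Y.emeasure_eq_measure law_weights_def)
qed

section \<open>Existence of maximizers\<close>

lemma continuous_on_x_ln_x: "continuous_on {0..} (\<lambda>t::real. t * ln t)"
  unfolding continuous_on_def
proof
  fix t :: real assume "t \<in> {0..}"
  then consider "t = 0" | "0 < t" by fastforce
  then show "((\<lambda>t. t * ln t) \<longlongrightarrow> t * ln t) (at t within {0..})"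
  proof cases
    case 1
    have "((\<lambda>t::real. t * ln t) \<longlongrightarrow> 0) (at_right 0)" by real_asymp
    with 1 show ?thesis by (simp add: at_within_Ici_at_right)
  next
    case 2
    then have "isCont (\<lambda>t. t * ln t) t" by (intro continuous_intros) auto
    then show ?thesis by (auto simp: isCont_def intro: tendsto_within_subset)
  qed
qed

lemma continuous_on_coordinate: "continuous_on A (\<lambda>p :: 'a \<Rightarrow> 'b::topological_space. p x)"
  by (rule continuous_on_subset[OF continuous_on_product_coordinates]) simp

lemma continuous_on_shannon_marginal:
  "continuous_on (prob_weights E) (\<lambda>p. shannon A (marginal E p f))"
proof -
  have "continuous_on (prob_weights E) (\<lambda>p. marginal E p f a * ln (marginal E p f a))" for a
    by (rule continuous_on_compose2[OF continuous_on_x_ln_x])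
       (auto simp: marginal_def prob_weights_def intro!: continuous_on_sum continuous_on_coordinate sum_nonneg)
  then show ?thesis
    unfolding shannon_def by (intro continuous_on_minus continuous_on_sum)
qed

lemma continuous_on_weights_functional:
  "continuous_on (prob_weights (configs d I)) (weights_functional c d I)"
proof -
  have "shannon (configs d I) p = shannon (configs d I) (marginal (configs d I) p id)" for p
    by (rule shannon_cong) (auto simp: marginal_def Collect_conv_if)
  then have "continuous_on (prob_weights (configs d I)) (\<lambda>p. shannon (configs d I) p)"
    by (subst continuous_on_cong[OF refl]) (assumption, rule continuous_on_shannon_marginal)
  then have "continuous_on (prob_weights (configs d I)) (\<lambda>p. weights_functional c d I p)"
    unfolding weights_functional_def
    by (intro continuous_on_sum continuous_on_mult continuous_on_const continuous_on_diff
        continuous_on_add continuous_on_shannon_marginal)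
  then show ?thesis .
qed

text \<open>
  The weights vanish off the finite set \<open>E\<close>; this makes them a closed part of a full product of unit
  intervals, to which Tychonoff's theorem applies.
\<close>

lemma compact_prob_weights:
  assumes "finite E"
  shows "compact (prob_weights E)"
proof -
  let ?K = "UNIV \<rightarrow>\<^sub>E {0..1::real} :: ('a \<Rightarrow> real) set"
  have "p x \<le> 1" if "p \<in> prob_weights E" for p x
  proof (cases "x \<in> E")
    case True
    have "p x \<le> sum p E"
      using that True assms by (intro member_le_sum) (auto simp: prob_weights_def)
    then show ?thesis using that by (simp add: prob_weights_def)
  qed (use that in \<open>simp add: prob_weights_def\<close>)
  then have "prob_weights E \<subseteq> ?K"
    by (auto simp: prob_weights_def PiE_iff) (metis order_refl)
  then have "prob_weights E = ?K \<inter> ((\<Inter>x\<in>-E. {p. p x = 0}) \<inter> {p. sum p E = 1})"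
    by (auto simp: prob_weights_def PiE_iff)
  moreover have "compact ?K"
    using compactin_PiE[of "\<lambda>_. euclidean" UNIV "\<lambda>_::'a. {0..1::real}"]
    by (simp add: euclidean_product_topology)
  moreover have "closed ((\<Inter>x\<in>-E. {p::'a \<Rightarrow> real. p x = 0}) \<inter> {p. sum p E = 1})"
    by (intro closed_Int closed_INT ballI closed_Collect_eq continuous_on_sum continuous_on_coordinate
        continuous_on_const)
  ultimately show ?thesis by (simp add: compact_Int_closed)
qed

text \<open>
  The closed set \<open>C\<close> is a constraint on the law. It allows one compactness argument to serve both for
  all systems (\<open>C = UNIV\<close>) and for the exchangeable ones (\<open>C\<close> the weights invariant under
  permutations).
\<close>

lemma ex_arg_max_mi_functional:
  assumes I: "index_set I" and C: "closed C"
    and ne: "prob_weights (configs d I) \<inter> C \<noteq> {}"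
  shows "\<exists>X. is_arg_max (mi_functional c I)
    (\<lambda>X. X \<in> (systems d I :: 'w::infinite system set) \<and> law_weights d I X \<in> C) X"
proof -
  let ?E = "configs d I"
  have fin: "finite I" "finite ?E" using I finite_configs by (auto simp: index_set_def)
  have "compact (prob_weights ?E \<inter> C)"
    using compact_prob_weights[OF fin(2)] C by (rule compact_Int_closed)
  moreover have "continuous_on (prob_weights ?E \<inter> C) (weights_functional c d I)"
    by (rule continuous_on_subset[OF continuous_on_weights_functional]) auto
  ultimately obtain p where p: "p \<in> prob_weights ?E" "p \<in> C" and
    max: "\<And>q. q \<in> prob_weights ?E \<inter> C \<Longrightarrow> weights_functional c d I q \<le> weights_functional c d I p"
    using continuous_attains_sup[OF _ ne, of "weights_functional c d I"] by blast
  obtain X :: "'w system" where X: "X \<in> systems d I" "law_weights d I X = p"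
    using prob_weights_realised[OF I p(1)] by blast
  have eq: "mi_functional c I Y = weights_functional c d I (law_weights d I Y)"
    "law_weights d I Y \<in> prob_weights ?E" if "Y \<in> systems d I" for Y :: "'w system"
    using mi_functional_eq_weights[of "fst Y" "snd Y"] law_weights_in_prob_weights[of "fst Y" "snd Y"]
      that fin by simp_all
  have "mi_functional c I Y \<le> mi_functional c I X"
    if "Y \<in> systems d I" "law_weights d I Y \<in> C" for Y :: "'w system"
    using max[of "law_weights d I Y"] that eq X by simp
  then show ?thesis
    using X p unfolding is_arg_max_def by (intro exI[of _ X]) (auto simp: not_less)
qed

lemma constant_system:
  assumes "0 < d"
  shows "\<exists>M. prob_space M \<and> (M, \<lambda>_ _. 0) \<in> (systems d I :: 'w system set)"
proof -
  have "prob_space (return (count_space UNIV) (undefined :: 'w))"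
    by (rule prob_space_return) simp
  then show ?thesis using assms by (auto simp: systems_def)
qed

section \<open>Exchangeable systems\<close>

lemma sub_vec_eq_iff: "x \<in> configs d I \<Longrightarrow> sub_vec X I \<omega> = x \<longleftrightarrow> (\<forall>i\<in>I. X i \<omega> = x i)"
  by (auto simp: sub_vec_def fun_eq_iff PiE_def extensional_def restrict_def)

lemma comp_permutes_configs:
  assumes "\<sigma> permutes I" "x \<in> configs d I"
  shows "x \<circ> \<sigma> \<in> configs d I"
  using assms permutes_in_image[OF assms(1)] permutes_not_in[OF assms(1)]
  by (auto simp: PiE_iff extensional_def)

lemma systems_permute:
  assumes "(M, X) \<in> systems d I" "\<sigma> permutes I"
  shows "(M, \<lambda>i. X (\<sigma> i)) \<in> systems d I"
  using assms permutes_in_image[OF assms(2)] by (auto simp: systems_def)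

lemma law_weights_permute:
  assumes sys: "(M, X) \<in> systems d I" and I: "finite I" and \<sigma>: "\<sigma> permutes I" and x: "x \<in> configs d I"
  shows "law_weights d I (M, \<lambda>i. X (\<sigma> i)) (x \<circ> \<sigma>) = law_weights d I (M, X) x"
proof -
  have "sub_vec (\<lambda>i. X (\<sigma> i)) I \<omega> = x \<circ> \<sigma> \<longleftrightarrow> sub_vec X I \<omega> = x" for \<omega>
  proof -
    have "sub_vec (\<lambda>i. X (\<sigma> i)) I \<omega> = x \<circ> \<sigma> \<longleftrightarrow> (\<forall>j\<in>\<sigma> ` I. X j \<omega> = x j)"
      using sub_vec_eq_iff[OF comp_permutes_configs[OF \<sigma> x]] by simp
    then show ?thesis
      by (simp only: permutes_image[OF \<sigma>] sub_vec_eq_iff[OF x])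
  qed
  then have "sub_vec (\<lambda>i. X (\<sigma> i)) I -` {x \<circ> \<sigma>} = sub_vec X I -` {x}"
    by (simp add: vimage_def)
  then show ?thesis
    using law_weights_eq[OF sys I x]
      law_weights_eq[OF systems_permute[OF sys \<sigma>] I comp_permutes_configs[OF \<sigma> x]] by simp
qed

text \<open>
  Exchangeability is a family of linear equations in the point masses, hence a closed condition.
\<close>

lemma exch_systems_iff:
  "(M, X) \<in> exch_systems d N \<longleftrightarrow> (M, X) \<in> systems d {1..N} \<and>
     law_weights d {1..N} (M, X) \<in>
       {p. \<forall>\<sigma> x. \<sigma> permutes {1..N} \<longrightarrow> x \<in> configs d {1..N} \<longrightarrow> p (x \<circ> \<sigma>) = p x}"
  (is "_ \<longleftrightarrow> _ \<and> ?R")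
proof (cases "(M, X) \<in> systems d {1..N}")
  case sys: True
  note perm = law_weights_permute[OF sys finite_atLeastAtMost]
  have "law d {1..N} (M, \<lambda>i. X (\<sigma> i)) = law d {1..N} (M, X) \<longleftrightarrow>
      (\<forall>x\<in>configs d {1..N}. law_weights d {1..N} (M, X) (x \<circ> \<sigma>) = law_weights d {1..N} (M, X) x)"
    (is "?L \<longleftrightarrow> (\<forall>x\<in>_. ?Q x)")
    if \<sigma>: "\<sigma> permutes {1..N}" for \<sigma>
  proof
    assume ?L
    then show "\<forall>x\<in>configs d {1..N}. ?Q x" using perm[OF \<sigma>] by (simp add: law_weights_def)
  next
    assume R: "\<forall>x\<in>configs d {1..N}. ?Q x"
    show ?L
    proof (rule law_eqI[OF finite_atLeastAtMost systems_permute[OF sys \<sigma>] sys])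
      fix y assume y: "y \<in> configs d {1..N}"
      define x where "x = y \<circ> inv \<sigma>"
      have x: "x \<in> configs d {1..N}"
        unfolding x_def using permutes_inv[OF \<sigma>] y by (rule comp_permutes_configs)
      have "x \<circ> \<sigma> = y"
        by (simp add: x_def comp_assoc permutes_inv_o[OF \<sigma>])
      then show "law_weights d {1..N} (M, \<lambda>i. X (\<sigma> i)) y = law_weights d {1..N} (M, X) y"
        using perm[OF \<sigma> x] R x by auto
    qed
  qed
  with sys show ?thesis by (auto simp: exch_systems_def)
qed (auto simp: exch_systems_def)

lemma closed_symmetric_weights:
  "closed {p :: ('a \<Rightarrow> 'b) \<Rightarrow> real. \<forall>\<sigma> x. P \<sigma> \<longrightarrow> Q x \<longrightarrow> p (x \<circ> \<sigma>) = p x}"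
proof -
  have "{p :: ('a \<Rightarrow> 'b) \<Rightarrow> real. \<forall>\<sigma> x. P \<sigma> \<longrightarrow> Q x \<longrightarrow> p (x \<circ> \<sigma>) = p x} =
      (\<Inter>\<sigma>\<in>Collect P. \<Inter>x\<in>Collect Q. {p. p (x \<circ> \<sigma>) = p x})" by auto
  then show ?thesis
    by (simp only:) (intro closed_INT ballI closed_Collect_eq continuous_on_coordinate)
qed

lemma ex_arg_max_exch_systems:
  assumes "0 < d"
  shows "\<exists>X. is_arg_max (mi_functional c {1..N})
    (\<lambda>X. X \<in> (exch_systems d N :: 'w::infinite system set)) X"
proof -
  let ?C = "{p :: (nat \<Rightarrow> nat) \<Rightarrow> real.
    \<forall>\<sigma> x. \<sigma> permutes {1..N} \<longrightarrow> x \<in> configs d {1..N} \<longrightarrow> p (x \<circ> \<sigma>) = p x}"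
  obtain M :: "'w measure" where sys: "(M, \<lambda>_ _. 0) \<in> systems d {1..N}"
    using constant_system[OF assms] by blast
  then have "(M, \<lambda>_ _. 0) \<in> exch_systems d N" by (auto simp: exch_systems_def)
  then have ne: "prob_weights (configs d {1..N}) \<inter> ?C \<noteq> {}"
    using law_weights_in_prob_weights[OF sys] exch_systems_iff by blast
  have "(X \<in> systems d {1..N} \<and> law_weights d {1..N} X \<in> ?C) \<longleftrightarrow> X \<in> exch_systems d N"
    for X :: "'w system"
    using exch_systems_iff[of "fst X" "snd X" d N] by simp
  then show ?thesis
    using ex_arg_max_mi_functional[OF _ closed_symmetric_weights ne, where ?'w = 'w, of c]
    by (simp add: index_set_def)
qed

lemma ex_maximizer:
  assumes "0 < d"
  shows "\<exists>X. X \<in> (maximizers d c N :: 'w::infinite system set)"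
proof -
  obtain M :: "'w measure" where sys: "(M, \<lambda>_ _. 0) \<in> systems d {1..N}"
    using constant_system[OF assms] by blast
  have ne: "prob_weights (configs d {1..N}) \<inter> UNIV \<noteq> {}"
    using law_weights_in_prob_weights[OF sys] by blast
  show ?thesis
    using ex_arg_max_mi_functional[OF _ closed_UNIV ne, where ?'w = 'w, of c]
    by (simp add: index_set_def maximizers_def)
qed

text \<open>
  The type, or empirical distribution, of a configuration on \<open>S\<close>: how often each value occurs.
\<close>

definition type_counts :: "nat \<Rightarrow> nat set \<Rightarrow> (nat \<Rightarrow> nat) \<Rightarrow> nat \<Rightarrow> nat" where
  "type_counts d S a = (\<lambda>v\<in>{..<d}. card {i \<in> S. a i = v})"

lemma card_type_counts_image_le:
  assumes "finite S"
  shows "card (type_counts d S ` A) \<le> (card S + 1) ^ d"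
proof -
  have "type_counts d S ` A \<subseteq> {..<d} \<rightarrow>\<^sub>E {..card S}"
    using assms unfolding type_counts_def
    by (intro image_subsetI) (simp add: restrict_PiE_iff card_mono)
  then have "card (type_counts d S ` A) \<le> card ({..<d} \<rightarrow>\<^sub>E {..card S})"
    by (intro card_mono finite_PiE) auto
  then show ?thesis by (simp add: card_PiE)
qed

lemma same_type_counts_imp_permutes:
  assumes S: "finite S" and a: "\<And>i. i \<in> S \<Longrightarrow> a i < d" and b: "\<And>i. i \<in> S \<Longrightarrow> b i < d"
    and eq: "type_counts d S a = type_counts d S b"
  obtains \<pi> where "\<pi> permutes S" "\<And>i. i \<in> S \<Longrightarrow> a i = b (\<pi> i)"
proof -
  have cnt: "count (image_mset h (mset_set S)) v = card {i \<in> S. h i = v}" for h :: "nat \<Rightarrow> nat" and v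
  proof -
    have "h -` {v} \<inter> S = {i \<in> S. h i = v}" by auto
    then show ?thesis using S by (simp add: count_image_mset count_mset_set)
  qed
  have "image_mset a (mset_set S) = image_mset b (mset_set S)"
  proof (rule multiset_eqI)
    fix v
    show "count (image_mset a (mset_set S)) v = count (image_mset b (mset_set S)) v"
    proof (cases "v < d")
      case True
      then show ?thesis using fun_cong[OF eq, of v] by (simp add: cnt type_counts_def)
    next
      case False
      then have "{i \<in> S. a i = v} = {}" "{i \<in> S. b i = v} = {}" using a b by auto
      then show ?thesis by (simp only: cnt)
    qed
  qed
  then show thesis
    using image_mset_eq_implies_permutes[OF S] that by metis
qed

text \<open>
  Giving each element the reciprocal size of its fibre lets every fibre contribute one.
\<close>

lemma sum_inverse_fibre_card:
  assumes "finite A"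
  shows "(\<Sum>a\<in>A. 1 / real (card {a' \<in> A. t a' = t a})) = real (card (t ` A))"
proof -
  have "(\<Sum>a\<in>A. 1 / real (card {a' \<in> A. t a' = t a})) =
      (\<Sum>y\<in>t ` A. \<Sum>a | a \<in> A \<and> t a = y. 1 / real (card {a' \<in> A. t a' = t a}))"
    by (rule sum.image_gen[OF assms])
  also have "\<dots> = (\<Sum>y\<in>t ` A. 1)"
  proof (rule sum.cong[OF refl])
    fix y assume "y \<in> t ` A"
    then have "card {a \<in> A. t a = y} \<noteq> 0" using assms by auto
    then show "(\<Sum>a | a \<in> A \<and> t a = y. 1 / real (card {a' \<in> A. t a' = t a})) = 1" by simp
  qed
  finally show ?thesis by simp
qed

text \<open>
  Given \<open>X\<close> outside \<open>S\<close>, the conditional law of \<open>X\<close> on \<open>S\<close> is invariant under permutations of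
  \<open>S\<close>, hence constant on each type class; so a configuration has conditional probability at most
  the reciprocal of the size of its class. There are at most \<open>(N + 1) ^ d\<close> types, and
  \<open>mutual_information_le_ln\<close> bounds the mutual information by the logarithm of their number. In other words,
  two parts of an exchangeable system share no more information than is contained in the counts.
\<close>

lemma exchangeable_MI_le:
  assumes exch: "(M, X) \<in> exch_systems d N" and S: "S \<subseteq> {1..N}"
  shows "MI M (sub_vec X S) (sub_vec X ({1..N} - S)) \<le> real d * ln (real N + 1)"
proof -
  let ?I = "{1..N}" and ?t = "type_counts d S"
  let ?E = "configs d ?I" and ?A = "configs d S" and ?B = "configs d (?I - S)"
  define p where "p = law_weights d ?I (M, X)"
  define n where "n a = real (card {a' \<in> ?A. ?t a' = ?t a})" for a
  have finS: "finite S" using S by (rule finite_subset) simp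
  have sys: "(M, X) \<in> systems d ?I"
    and sym: "\<And>\<sigma> x. \<sigma> permutes ?I \<Longrightarrow> x \<in> ?E \<Longrightarrow> p (x \<circ> \<sigma>) = p x"
    using exch exch_systems_iff[of M X d N] by (auto simp: p_def)
  have p: "\<And>x. x \<in> ?E \<Longrightarrow> 0 \<le> p x" "sum p ?E = 1"
    using law_weights_in_prob_weights[OF sys] by (auto simp: p_def prob_weights_def)
  have fin: "finite ?E" "finite ?A" "finite ?B"
    using finS by (auto intro!: finite_configs)
  have spread: "n (restrict x S) * p x \<le> marginal ?E p (\<lambda>x. restrict x (?I - S)) (restrict x (?I - S))"
    if x: "x \<in> ?E" for x
  proof -
    let ?C = "{a' \<in> ?A. ?t a' = ?t (restrict x S)}"
    \<comment> \<open>Replacing \<open>x\<close> on \<open>S\<close> by another configuration of the same type does not change its mass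
      and gives a configuration in the same fibre over the complement of \<open>S\<close>.\<close>
    define h where "h a = (\<lambda>i. if i \<in> S then a i else x i)" for a :: "nat \<Rightarrow> nat"
    have h: "h a \<in> ?E \<and> p (h a) = p x" if a: "a \<in> ?C" for a
    proof -
      obtain \<pi> where \<pi>: "\<pi> permutes S" "\<And>i. i \<in> S \<Longrightarrow> a i = restrict x S (\<pi> i)"
      proof (rule same_type_counts_imp_permutes[OF finS])
        show "a i < d" "restrict x S i < d" if "i \<in> S" for i
          using a x S that by (auto simp: PiE_iff)
        show "?t a = ?t (restrict x S)" using a by simp
      qed blast
      have "h a = x \<circ> \<pi>"
        using \<pi> permutes_in_image[OF \<pi>(1)] permutes_not_in[OF \<pi>(1)] by (auto simp: h_def fun_eq_iff)
      then show ?thesis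
        using sym[of \<pi> x] comp_permutes_configs[of \<pi> ?I x d] permutes_subset[OF \<pi>(1) S] x by simp
    qed
    have inj: "inj_on h ?C"
    proof (rule inj_onI)
      fix a b assume "a \<in> ?C" "b \<in> ?C" "h a = h b"
      then show "a = b"
        by (intro PiE_ext[of a S _ b]) (auto simp: h_def fun_eq_iff split: if_splits)
    qed
    have "restrict (h a) (?I - S) = restrict x (?I - S)" for a
      by (auto simp: h_def fun_eq_iff)
    then have sub: "h ` ?C \<subseteq> {y \<in> ?E. restrict y (?I - S) = restrict x (?I - S)}"
      using h by blast
    have "n (restrict x S) * p x = (\<Sum>a\<in>?C. p (h a))"
      using h by (simp add: n_def)
    also have "\<dots> = sum p (h ` ?C)" by (simp add: sum.reindex[OF inj])
    also have "\<dots> \<le> (\<Sum>y | y \<in> ?E \<and> restrict y (?I - S) = restrict x (?I - S). p y)"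
      using sub fin(1) p(1) by (intro sum_mono2) (auto intro: finite_subset[OF _ fin(1)])
    finally show ?thesis by (simp add: marginal_def)
  qed
  have "real (card (?t ` ?A)) \<le> real ((card S + 1) ^ d)"
    using card_type_counts_image_le[OF finS] of_nat_le_iff by blast
  also have "\<dots> \<le> (real N + 1) ^ d"
    using card_mono[OF _ S] by (simp add: power_mono)
  finally have K: "(\<Sum>a\<in>?A. 1 / n a) \<le> (real N + 1) ^ d"
    unfolding n_def by (simp add: sum_inverse_fibre_card[OF fin(2)])
  have "MI M (sub_vec X S) (sub_vec X (?I - S)) =
      shannon ?A (marginal ?E p (\<lambda>x. restrict x S)) +
      shannon ?B (marginal ?E p (\<lambda>x. restrict x (?I - S))) - shannon ?E p"
    unfolding MI_def p_def ent_sub_vec[OF sys finite_atLeastAtMost S]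
      ent_sub_vec[OF sys finite_atLeastAtMost Diff_subset]
      ent_sub_vec_pair[OF sys finite_atLeastAtMost S] ..
  also have "\<dots> \<le> ln ((real N + 1) ^ d)"
  proof (rule mutual_information_le_ln[OF fin _ _ p _ spread K])
    show "(\<lambda>x. restrict x S) ` ?E \<subseteq> ?A" "(\<lambda>x. restrict x (?I - S)) ` ?E \<subseteq> ?B"
      using S by (intro image_subsetI, simp only: restrict_PiE_iff, blast dest: PiE_mem)+
    show "0 < n a" if "a \<in> ?A" for a
    proof -
      have "a \<in> {a' \<in> ?A. ?t a' = ?t a}" using that by simp
      then have "card {a' \<in> ?A. ?t a' = ?t a} \<noteq> 0" using fin(2) by auto
      then show ?thesis unfolding n_def by simp
    qed
  qed
  also have "\<dots> = real d * ln (real N + 1)" by (simp add: ln_realpow)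
  finally show ?thesis .
qed

lemma exchangeable_mi_functional_le:
  assumes c: "coefficient_system c" and exch: "(M, X) \<in> exch_systems d N"
  shows "mi_functional c {1..N} (M, X) \<le> real d * ln (real N + 1)"
proof -
  let ?I = "{1..N}"
  have I: "index_set ?I" by (simp add: index_set_def)
  have "mi_functional c ?I (M, X) \<le> (\<Sum>S\<in>Pow ?I. c ?I S * (real d * ln (real N + 1)))"
    unfolding mi_functional_def prod.case
    using c I exchangeable_MI_le[OF exch]
    by (intro sum_mono mult_left_mono) (auto simp: coefficient_system_def)
  also have "\<dots> = real d * ln (real N + 1)"
    using c I unfolding coefficient_system_def by (simp flip: sum_distrib_right)
  finally show ?thesis .
qed

section \<open>Linear growth of the maximum\<close>

lemma law_restrict:
  assumes Z: "(M, Z) \<in> systems d T" and S: "S \<subseteq> T"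
  shows "law d S (M, Z) = distr (law d T (M, Z)) (state_space d S) (\<lambda>f. restrict f S)"
proof -
  have "(\<lambda>f. restrict f S) \<circ> sub_vec Z T = sub_vec Z S"
    using S by (auto simp: sub_vec_def fun_eq_iff)
  then show ?thesis
    using distr_distr[OF measurable_restrict_subset[OF S] measurable_sub_vec[OF Z order_refl]]
    by (simp add: law_def)
qed

lemma mi_functional_cong_law:
  assumes "(M, X) \<in> systems d I" "(M', Y) \<in> systems d I" "finite I" "law d I (M, X) = law d I (M', Y)"
  shows "mi_functional c I (M, X) = mi_functional c I (M', Y)"
proof -
  have "law_weights d I (M, X) = law_weights d I (M', Y)"
    using assms(4) by (simp add: law_weights_def fun_eq_iff)
  then show ?thesis
    using mi_functional_eq_weights[OF assms(1,3)] mi_functional_eq_weights[OF assms(2,3)] by simp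
qed

lemma distr_pair_measure_snd:
  assumes "prob_space M" "prob_space N"
  shows "distr (M \<Otimes>\<^sub>M N) N snd = N"
proof -
  interpret M: prob_space M by fact
  interpret N: prob_space N by fact
  interpret pair_sigma_finite M N ..
  have "distr (M \<Otimes>\<^sub>M N) N snd = distr (distr (N \<Otimes>\<^sub>M M) (M \<Otimes>\<^sub>M N) (\<lambda>(x, y). (y, x))) N snd"
    using distr_pair_swap by simp
  also have "\<dots> = distr (N \<Otimes>\<^sub>M M) N fst"
    by (subst distr_distr) (auto intro!: distr_cong simp: comp_def case_prod_beta)
  finally show ?thesis by (simp add: M.distr_pair_fst)
qed

lemma distr_sub_vec_pair:
  assumes V: "(M, V) \<in> systems d (I \<union> J)"
  shows "distr M (state_space d I \<Otimes>\<^sub>M state_space d J) (\<lambda>\<omega>. (sub_vec V I \<omega>, sub_vec V J \<omega>)) =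
    distr (law d (I \<union> J) (M, V)) (state_space d I \<Otimes>\<^sub>M state_space d J)
      (\<lambda>f. (restrict f I, restrict f J))"
proof -
  have "(\<lambda>f. (restrict f I, restrict f J)) \<circ> sub_vec V (I \<union> J) = (\<lambda>\<omega>. (sub_vec V I \<omega>, sub_vec V J \<omega>))"
    by (auto simp: sub_vec_def fun_eq_iff)
  moreover have "(\<lambda>f. (restrict f I, restrict f J)) \<in>
      state_space d (I \<union> J) \<rightarrow>\<^sub>M state_space d I \<Otimes>\<^sub>M state_space d J"
    by (intro measurable_Pair measurable_restrict_subset) auto
  ultimately show ?thesis
    using distr_distr[OF _ measurable_sub_vec[OF V order_refl],
        of "\<lambda>f. (restrict f I, restrict f J)" "state_space d I \<Otimes>\<^sub>M state_space d J"]
    by (simp add: law_def)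
qed

text \<open>
  Weak additivity needs two systems on one probability space. They are put on the product space,
  whose law is then realised on the original sample type; independence depends on the joint law
  only and survives this transfer.
\<close>

lemma ex_independent_union:
  fixes X Y :: "nat \<Rightarrow> 'w::infinite \<Rightarrow> nat"
  assumes I: "index_set I" and J: "index_set J" and disj: "I \<inter> J = {}"
    and X: "(M1, X) \<in> systems d I" and Y: "(M2, Y) \<in> systems d J"
    and add: "weakly_additive TYPE('w) d c"
  shows "\<exists>Z :: 'w system. Z \<in> systems d (I \<union> J) \<and>
    mi_functional c (I \<union> J) Z = mi_functional c I (M1, X) + mi_functional c J (M2, Y)"
proof -
  interpret M1: prob_space M1 using X by (simp add: systems_def)
  interpret M2: prob_space M2 using Y by (simp add: systems_def)
  interpret P: pair_prob_space M1 M2 ..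
  let ?P = "M1 \<Otimes>\<^sub>M M2" and ?T = "I \<union> J"
  define W where "W k = (if k \<in> I then X k \<circ> fst else Y k \<circ> snd)" for k
  have W: "(?P, W) \<in> systems d ?T"
    using X Y P.prob_space_axioms
    by (auto simp: systems_def W_def intro!: measurable_comp[OF measurable_fst] measurable_comp[OF measurable_snd])
  have fin: "finite I" "finite J" "finite ?T" and T: "index_set ?T"
    using I J by (auto simp: index_set_def)
  obtain M and Z :: "nat \<Rightarrow> 'w \<Rightarrow> nat" where Z: "(M, Z) \<in> systems d ?T"
    and law: "law d ?T (M, Z) = law d ?T (?P, W)"
    using laws_realised[OF T law_in_laws[OF W]] by blast
  interpret M: prob_space M using Z by (simp add: systems_def)
  have WI: "sub_vec W I = (\<lambda>\<omega>. sub_vec X I (fst \<omega>))" and WJ: "sub_vec W J = (\<lambda>\<omega>. sub_vec Y J (snd \<omega>))"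
    using disj by (auto simp: sub_vec_def W_def fun_eq_iff)
  have lawI: "law d I (M, Z) = law d I (M1, X)"
  proof -
    have "law d I (M, Z) = law d I (?P, W)"
      using law_restrict[OF Z, of I] law_restrict[OF W, of I] law by simp
    also have "\<dots> = distr (distr ?P M1 fst) (state_space d I) (sub_vec X I)"
      using measurable_sub_vec[OF X order_refl] by (simp add: law_def WI distr_distr comp_def)
    finally show ?thesis by (simp add: law_def M2.distr_pair_fst)
  qed
  have lawJ: "law d J (M, Z) = law d J (M2, Y)"
  proof -
    have "law d J (M, Z) = law d J (?P, W)"
      using law_restrict[OF Z, of J] law_restrict[OF W, of J] law by simp
    also have "\<dots> = distr (distr ?P M2 snd) (state_space d J) (sub_vec Y J)"
      using measurable_sub_vec[OF Y order_refl] by (simp add: law_def WJ distr_distr comp_def)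
    finally show ?thesis
      using distr_pair_measure_snd[OF M1.prob_space_axioms M2.prob_space_axioms] by (simp add: law_def)
  qed
  have "distr M (state_space d I \<Otimes>\<^sub>M state_space d J) (\<lambda>\<omega>. (sub_vec Z I \<omega>, sub_vec Z J \<omega>)) =
      distr ?P (state_space d I \<Otimes>\<^sub>M state_space d J) (\<lambda>\<omega>. (sub_vec W I \<omega>, sub_vec W J \<omega>))"
    by (simp add: distr_sub_vec_pair[OF Z] distr_sub_vec_pair[OF W] law)
  also have "\<dots> = law d I (M1, X) \<Otimes>\<^sub>M law d J (M2, Y)"
    using pair_measure_distr[OF measurable_sub_vec[OF X order_refl] measurable_sub_vec[OF Y order_refl]]
      M2.prob_space_distr[OF measurable_sub_vec[OF Y order_refl]]
    by (simp add: law_def WI WJ case_prod_unfold prob_space_imp_sigma_finite)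
  also have "\<dots> = law d I (M, Z) \<Otimes>\<^sub>M law d J (M, Z)"
    by (simp only: lawI lawJ)
  finally have "M.indep_var (state_space d I) (sub_vec Z I) (state_space d J) (sub_vec Z J)"
    using measurable_sub_vec[OF Z] by (simp add: M.indep_var_distribution_eq law_def)
  moreover have ZI: "(M, Z) \<in> systems d I" and ZJ: "(M, Z) \<in> systems d J"
    using Z by (auto simp: systems_def)
  ultimately have "mi_functional c ?T (M, \<lambda>k. if k \<in> I then Z k else Z k) =
      mi_functional c I (M, Z) + mi_functional c J (M, Z)"
    using add I J disj unfolding weakly_additive_def by blast
  then have "mi_functional c ?T (M, Z) = mi_functional c I (M1, X) + mi_functional c J (M2, Y)"
    using mi_functional_cong_law[OF ZI X fin(1) lawI] mi_functional_cong_law[OF ZJ Y fin(2) lawJ]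
    by simp
  with Z show ?thesis by blast
qed

text \<open>
  The functional is exchangeable, so a copy of \<open>X\<close> can be placed on any block of \<open>card I\<close> consecutive
  indices with the same value; \<open>k\<close> independent copies on consecutive blocks add up.
\<close>

lemma ex_system_of_copies:
  fixes X :: "nat \<Rightarrow> 'w::infinite \<Rightarrow> nat"
  assumes d: "0 < d" and int: "intricacy TYPE('w) d c"
    and I: "index_set I" and X: "(M, X) \<in> systems d I"
  shows "\<exists>Z :: 'w system. Z \<in> systems d {1..k * card I} \<and>
    real k * mi_functional c I (M, X) \<le> mi_functional c {1..k * card I} Z"
proof (induction k)
  case 0
  have c: "coefficient_system c" using int by (simp add: intricacy_def)
  obtain M0 :: "'w measure" where "(M0, \<lambda>_ _. 0) \<in> systems d {1..0 * card I}"
    using constant_system[OF d] by blast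
  then show ?case
    using mi_functional_nonneg[OF c, of "{1..0 * card I}" M0 "\<lambda>_ _. 0" d]
    by (intro exI[of _ "(M0, \<lambda>_ _. 0)"]) (simp add: index_set_def)
next
  case (Suc k)
  let ?m = "card I"
  let ?J = "{k * ?m + 1..Suc k * ?m}"
  obtain L and Z :: "nat \<Rightarrow> 'w \<Rightarrow> nat" where Z: "(L, Z) \<in> systems d {1..k * ?m}"
    "real k * mi_functional c I (M, X) \<le> mi_functional c {1..k * ?m} (L, Z)"
    using Suc by auto
  have J: "index_set ?J" by (simp add: index_set_def)
  have "finite I" using I by (simp add: index_set_def)
  then obtain \<phi> where \<phi>: "bij_betw \<phi> I ?J"
    using finite_same_card_bij[of I ?J] by auto
  define Y where "Y j = X (inv_into I \<phi> j)" for j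
  have Y: "(M, Y) \<in> systems d ?J"
    using X \<phi> by (auto simp: systems_def Y_def bij_betw_def inv_into_into)
  have mi: "mi_functional c ?J (M, Y) = mi_functional c I (M, X)"
    using int I J \<phi> X unfolding intricacy_def exchangeable_functional_def Y_def by metis
  have un: "{1..k * ?m} \<union> ?J = {1..Suc k * ?m}" by auto
  obtain V :: "'w system" where "V \<in> systems d {1..Suc k * ?m}"
    "mi_functional c {1..Suc k * ?m} V = mi_functional c {1..k * ?m} (L, Z) + mi_functional c ?J (M, Y)"
    using ex_independent_union[of "{1..k * ?m}" ?J L Z d M Y c] J Z(1) Y int
    unfolding un by (auto simp: index_set_def intricacy_def)
  then show ?case using Z(2) mi by (intro exI[of _ V]) (simp add: algebra_simps)
qed

text \<open>
  As many copies of \<open>X\<close> as fit into \<open>{1..N}\<close>, with constants at the remaining indices.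
\<close>

lemma maximum_grows_linearly:
  fixes X :: "nat \<Rightarrow> 'w::infinite \<Rightarrow> nat"
  assumes d: "0 < d" and int: "intricacy TYPE('w) d c"
    and I: "index_set I" and X: "(M, X) \<in> systems d I"
  shows "\<exists>Z :: 'w system. Z \<in> systems d {1..N} \<and>
    real (N div card I) * mi_functional c I (M, X) \<le> mi_functional c {1..N} Z"
proof -
  let ?n = "N div card I * card I"
  obtain L and Z :: "nat \<Rightarrow> 'w \<Rightarrow> nat" where Z: "(L, Z) \<in> systems d {1..?n}"
    "real (N div card I) * mi_functional c I (M, X) \<le> mi_functional c {1..?n} (L, Z)"
    using ex_system_of_copies[OF assms, of "N div card I"] by auto
  obtain M0 :: "'w measure" where M0: "(M0, \<lambda>_ _. 0) \<in> systems d {?n + 1..N}"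
    using constant_system[OF d] by blast
  have un: "{1..?n} \<union> {?n + 1..N} = {1..N}"
    using div_times_less_eq_dividend[of N "card I"]
    by (auto simp del: div_times_less_eq_dividend dest: order_trans)
  obtain V :: "'w system" where V: "V \<in> systems d {1..N}"
    "mi_functional c {1..N} V = mi_functional c {1..?n} (L, Z) + mi_functional c {?n + 1..N} (M0, \<lambda>_ _. 0)"
    using ex_independent_union[of "{1..?n}" "{?n + 1..N}" L Z d M0 "\<lambda>_ _. 0" c] Z(1) M0 int
    unfolding un by (auto simp: index_set_def intricacy_def)
  have "0 \<le> mi_functional c {?n + 1..N} (M0, \<lambda>_ _. 0)"
    using int M0 by (intro mi_functional_nonneg) (auto simp: index_set_def intricacy_def)
  with V Z(2) show ?thesis by (intro exI[of _ V]) simp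
qed

section \<open>Small intricacy of exchangeable systems and symmetry breaking\<close>

lemma mi_functional_empty:
  assumes "(M, X) \<in> systems d {}"
  shows "mi_functional c {} (M, X) = 0"
  using MI_trivial(1)[of "{}" M X d] assms by (simp add: mi_functional_def index_set_def)

text \<open>
  Permuting the indices of a maximizer gives a maximizer, since the functional is exchangeable.
  Unless the system itself is exchangeable, some permutation changes its law.
\<close>

lemma maximizer_with_other_law:
  assumes max: "(M, X) \<in> (maximizers d c N :: 'w system set)"
    and c: "exchangeable_functional TYPE('w) d c"
    and not_exch: "(M, X) \<notin> exch_systems d N"
  shows "\<exists>Y \<in> (maximizers d c N :: 'w system set). law d {1..N} Y \<noteq> law d {1..N} (M, X)"
proof -
  let ?I = "{1..N}"
  have X: "(M, X) \<in> systems d ?I" using max by (simp add: maximizers_def is_arg_max_def)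
  then obtain \<sigma> where \<sigma>: "\<sigma> permutes ?I" and ne: "law d ?I (M, \<lambda>i. X (\<sigma> i)) \<noteq> law d ?I (M, X)"
    using not_exch by (auto simp: exch_systems_def)
  \<comment> \<open>In \<open>exchangeable_functional\<close> the bijection \<open>\<phi>\<close> acts through its inverse, so it is taken to be
    \<open>inv \<sigma>\<close>.\<close>
  have inv: "inv_into ?I (inv \<sigma>) j = \<sigma> j" if "j \<in> ?I" for j
    by (rule inv_into_f_eq[OF permutes_inj_on[OF permutes_inv[OF \<sigma>]]])
       (simp_all only: that permutes_in_image[OF \<sigma>] permutes_inverses(2)[OF \<sigma>])
  have "sub_vec (\<lambda>j. X (inv_into ?I (inv \<sigma>) j)) S = sub_vec (\<lambda>j. X (\<sigma> j)) S" if "S \<subseteq> ?I" for S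
    unfolding sub_vec_def by (intro ext restrict_ext) (use that inv in \<open>simp add: subset_iff\<close>)
  then have "mi_functional c ?I (M, \<lambda>j. X (inv_into ?I (inv \<sigma>) j)) = mi_functional c ?I (M, \<lambda>j. X (\<sigma> j))"
    unfolding mi_functional_def prod.case by (intro sum.cong) auto
  moreover have "mi_functional c ?I (M, X) = mi_functional c ?I (M, \<lambda>j. X (inv_into ?I (inv \<sigma>) j))"
    using c X permutes_imp_bij[OF permutes_inv[OF \<sigma>]]
    unfolding exchangeable_functional_def by (simp add: index_set_def)
  ultimately have "(M, \<lambda>i. X (\<sigma> i)) \<in> maximizers d c N"
    using max systems_permute[OF X \<sigma>] by (simp add: maximizers_def is_arg_max_def)
  then show ?thesis using ne by blast
qed

theorem theorem1p5:
  fixes d :: nat and c :: "nat set \<Rightarrow> nat set \<Rightarrow> real"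
  assumes "d \<ge> 2"
    and "intricacy TYPE('w::infinite) d c"
  shows
    "(\<forall>\<epsilon>>0. (\<lambda>N. SUP X\<in>(exch_systems d N :: 'w system set). mi_functional c {1..N} X)
        \<in> o(\<lambda>N. real N powr (2 / 3 + \<epsilon>))) \<and>
     (\<forall>N. \<exists>X. is_arg_max (mi_functional c {1..N})
        (\<lambda>X. X \<in> (exch_systems d N :: 'w system set)) X) \<and>
     (\<lambda>N. 1 / real N *
        (SUP X\<in>(exch_systems d N :: 'w system set). mi_functional c {1..N} X)) \<longlonglongrightarrow> 0 \<and>
     (nonnull_functional TYPE('w) d c \<longrightarrow>
       (\<forall>\<^sub>F N in sequentially.
          (\<exists>X Y. X \<in> (maximizers d c N :: 'w system set) \<and>
                 Y \<in> (maximizers d c N :: 'w system set) \<and>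
                 law d {1..N} X \<noteq> law d {1..N} Y) \<and>
          (maximizers d c N :: 'w system set) \<inter> exch_systems d N = {}))"
proof -
  have d: "0 < d" using assms(1) by simp
  have c: "coefficient_system c" and exch: "exchangeable_functional TYPE('w) d c"
    using assms(2) by (auto simp: intricacy_def)
  define s where "s N = (SUP X\<in>(exch_systems d N :: 'w system set). mi_functional c {1..N} X)" for N
  note argmax = ex_arg_max_exch_systems[OF d, where ?'w = 'w, of c]
  have s: "0 \<le> s N" "s N \<le> real d * ln (real N + 1)" for N
  proof -
    obtain M and X :: "nat \<Rightarrow> 'w \<Rightarrow> nat" where
      X: "is_arg_max (mi_functional c {1..N}) (\<lambda>X. X \<in> exch_systems d N) (M, X)"
      using argmax[of N] by auto
    then have ex: "(M, X) \<in> exch_systems d N" by (simp add: is_arg_max_def)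
    have "s N = mi_functional c {1..N} (M, X)"
      unfolding s_def using X by (intro cSup_eq_maximum) (auto simp: is_arg_max_def not_less)
    moreover have "0 \<le> mi_functional c {1..N} (M, X)"
      using ex by (intro mi_functional_nonneg[OF c]) (auto simp: index_set_def exch_systems_def)
    ultimately show "0 \<le> s N" "s N \<le> real d * ln (real N + 1)"
      using exchangeable_mi_functional_le[OF c ex] by auto
  qed
  have "s \<in> o(\<lambda>N. real N powr (2 / 3 + \<epsilon>))" if "\<epsilon> > 0" for \<epsilon> :: real
  proof -
    have "s \<in> O(\<lambda>N. real d * ln (real N + 1))"
      using s by (intro bigoI[of _ 1]) auto
    also have "(\<lambda>N. real d * ln (real N + 1)) \<in> o(\<lambda>N. real N powr (2 / 3 + \<epsilon>))"
      using that by real_asymp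
    finally show ?thesis .
  qed
  moreover have "(\<lambda>N. 1 / real N * s N) \<longlonglongrightarrow> 0"
  proof (rule tendsto_sandwich[OF _ _ tendsto_const])
    show "(\<lambda>N. 1 / real N * (real d * ln (real N + 1))) \<longlonglongrightarrow> 0" by real_asymp
    show "\<forall>\<^sub>F N in sequentially. 0 \<le> 1 / real N * s N"
      using s(1) by simp
    show "\<forall>\<^sub>F N in sequentially. 1 / real N * s N \<le> 1 / real N * (real d * ln (real N + 1))"
      using s(2) by (intro always_eventually allI mult_left_mono) auto
  qed
  moreover have "\<forall>\<^sub>F N in sequentially.
      (\<exists>X Y. X \<in> (maximizers d c N :: 'w system set) \<and> Y \<in> (maximizers d c N :: 'w system set) \<and>
        law d {1..N} X \<noteq> law d {1..N} Y) \<and>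
      (maximizers d c N :: 'w system set) \<inter> exch_systems d N = {}"
    if "nonnull_functional TYPE('w) d c"
  proof -
    obtain I M and X :: "nat \<Rightarrow> 'w \<Rightarrow> nat" where I: "index_set I" and X: "(M, X) \<in> systems d I"
      and "mi_functional c I (M, X) \<noteq> 0"
      using \<open>nonnull_functional TYPE('w) d c\<close> by (auto simp: nonnull_functional_def)
    define \<delta> m where "\<delta> = mi_functional c I (M, X)" and "m = real (card I)"
    have \<delta>: "0 < \<delta>"
      using mi_functional_nonneg[OF c I X] \<open>mi_functional c I (M, X) \<noteq> 0\<close> by (simp add: \<delta>_def)
    have m: "0 < m"
      using I X \<open>mi_functional c I (M, X) \<noteq> 0\<close> mi_functional_empty[of M X d c]
      by (auto simp: m_def card_gt_0_iff index_set_def)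
    have "\<forall>\<^sub>F N in sequentially. real d * ln (real N + 1) < (real N / m - 1) * \<delta>"
      using \<delta> m by real_asymp
    then show ?thesis
    proof eventually_elim
      case (elim N)
      have "real N / m - 1 \<le> real (N div card I)"
        using floor_divide_of_nat_eq[of N "card I", where ?'a = real] unfolding m_def by linarith
      then have "(real N / m - 1) * \<delta> \<le> real (N div card I) * \<delta>"
        using \<delta> by (intro mult_right_mono) auto
      moreover obtain Z :: "'w system" where Z: "Z \<in> systems d {1..N}"
        "real (N div card I) * \<delta> \<le> mi_functional c {1..N} Z"
        using maximum_grows_linearly[OF d assms(2) I X, of N] unfolding \<delta>_def by blast
      ultimately have big: "real d * ln (real N + 1) < mi_functional c {1..N} Z"
        using elim by linarith
      have not_exch: "V \<notin> exch_systems d N" if "V \<in> maximizers d c N" for V :: "'w system"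
      proof
        assume "V \<in> exch_systems d N"
        then have "mi_functional c {1..N} V < mi_functional c {1..N} Z"
          using exchangeable_mi_functional_le[OF c, of "fst V" "snd V" d N] big by simp
        then show False using that Z(1) unfolding maximizers_def is_arg_max_def by blast
      qed
      obtain L and V :: "nat \<Rightarrow> 'w \<Rightarrow> nat" where V: "(L, V) \<in> maximizers d c N"
        using ex_maximizer[OF d, where ?'w = 'w, of c N] by auto
      then obtain Y :: "'w system" where "Y \<in> maximizers d c N" "law d {1..N} Y \<noteq> law d {1..N} (L, V)"
        using maximizer_with_other_law[OF V exch not_exch[OF V]] by blast
      then show ?case using V not_exch by blast
    qed
  qed
  ultimately show ?thesis
    using argmax unfolding s_def by blast
qed

end
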